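(* Let $a\ge 0$ and let $f:[a,b]\to[0,\infty)$ and $g:[a,b]\to[0,\infty)$ be differentiable functions satisfying the following (i)-(iv): (i) $f$ is monotone increasing and concave; (ii) $g$ is convex; (iii) $f(x)\ge g(x)$ for all $x\in[a,b]$; and (iv) $f(b)-f(a)\ge M_{\mathrm{ratio}}(f,g)\,(g(b)-g(a))\ge 0$, where $$M_{\mathrm{ratio}}(f,g):=\frac{\max_{x\in[a,b]}\{f(x)\}}{\min_{x\in[a,b]}\{g(x)\}}.$$ Then, for any positive operator $A$ on a Hilbert space $\mathcal H$ with $a\mathbf 1_{\mathcal H}\le A\le b\mathbf 1_{\mathcal H}$, and a unit vector $h\in\mathcal H$, we have $$(g(b)-g(a))\,f(\langle Ah,h\rangle)\le (f(b)-f(a))\,\langle g(A)h,h\rangle.$$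
   Context: $\mathcal H$ is a Hilbert space with inner product $\langle\cdot,\cdot\rangle$ and identity operator $\mathbf 1_{\mathcal H}$. A self-adjoint operator $A$ is positive if $\langle Ax,x\rangle\ge0$ for all $x\in\mathcal H$; for self-adjoint $A,B$, $A\ge B$ means that $A-B$ is positive. $g(A)$ is understood in the sense of the functional calculus. *)

theory Defs
  imports "HOL-Analysis.Analysis" "HOL-Computational_Algebra.Polynomial"
begin

text \<open>
  The inner product is linear in its first argument. The last axiom says that the norm (and with it
  the complete metric of the class \<^class>\<open>banach\<close>) is the one induced by the inner product; it also
  gives positive definiteness.
\<close>

class complex_hilbert_space = banach +
  fixes scaleC :: "complex \<Rightarrow> 'a \<Rightarrow> 'a" (infixr "*\<^sub>C" 75)
    and cinner :: "'a \<Rightarrow> 'a \<Rightarrow> complex"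
  assumes scaleC_add_right: "c *\<^sub>C (x + y) = c *\<^sub>C x + c *\<^sub>C y"
    and scaleC_add_left: "(c + d) *\<^sub>C x = c *\<^sub>C x + d *\<^sub>C x"
    and scaleC_scaleC: "c *\<^sub>C d *\<^sub>C x = (c * d) *\<^sub>C x"
    and scaleC_of_real: "complex_of_real r *\<^sub>C x = r *\<^sub>R x"
    and cinner_commute: "cinner x y = cnj (cinner y x)"
    and cinner_add_left: "cinner (x + y) z = cinner x z + cinner y z"
    and cinner_scaleC_left: "cinner (c *\<^sub>C x) y = c * cinner x y"
    and cinner_self: "cinner x x = complex_of_real ((norm x)\<^sup>2)"

instantiation complex :: complex_hilbert_space
begin

definition scaleC_complex :: "complex \<Rightarrow> complex \<Rightarrow> complex"
  where "scaleC_complex c x = c * x"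

definition cinner_complex :: "complex \<Rightarrow> complex \<Rightarrow> complex"
  where "cinner_complex x y = x * cnj y"

instance
  by standard
    (simp_all add: scaleC_complex_def cinner_complex_def algebra_simps scaleR_conv_of_real
      complex_norm_square del: of_real_power)

end

text \<open>
  The library type of bounded linear maps is real-linear, so complex linearity is stated separately.
\<close>

definition complex_linear :: "('h::complex_hilbert_space \<Rightarrow>\<^sub>L 'h) \<Rightarrow> bool"
  where "complex_linear T \<longleftrightarrow> (\<forall>c x. T (c *\<^sub>C x) = c *\<^sub>C T x)"

definition self_adjoint :: "('h::complex_hilbert_space \<Rightarrow>\<^sub>L 'h) \<Rightarrow> bool"
  where "self_adjoint T \<longleftrightarrow> complex_linear T \<and> (\<forall>x y. cinner (T x) y = cinner x (T y))"

text \<open>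
  For self-adjoint \<open>T\<close> the number \<open>cinner (T x) x\<close> is real, so nothing is lost by taking real parts.
\<close>

definition positive_op :: "('h::complex_hilbert_space \<Rightarrow>\<^sub>L 'h) \<Rightarrow> bool"
  where "positive_op T \<longleftrightarrow> self_adjoint T \<and> (\<forall>x. 0 \<le> Re (cinner (T x) x))"

definition op_le :: "('h::complex_hilbert_space \<Rightarrow>\<^sub>L 'h) \<Rightarrow> ('h \<Rightarrow>\<^sub>L 'h) \<Rightarrow> bool"
  where "op_le S T \<longleftrightarrow> self_adjoint S \<and> self_adjoint T \<and> positive_op (T - S)"

definition op_spectrum :: "('h::complex_hilbert_space \<Rightarrow>\<^sub>L 'h) \<Rightarrow> complex set"
  where "op_spectrum T =
    {z. \<not> (\<exists>R :: 'h \<Rightarrow>\<^sub>L 'h. complex_linear R \<and>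
            (\<forall>x. R (T x - z *\<^sub>C x) = x \<and> T (R x) - z *\<^sub>C R x = x))}"

definition op_power :: "('h::complex_hilbert_space \<Rightarrow>\<^sub>L 'h) \<Rightarrow> nat \<Rightarrow> ('h \<Rightarrow>\<^sub>L 'h)"
  where "op_power T n = ((\<lambda>S. T o\<^sub>L S) ^^ n) id_blinfun"

definition poly_op :: "real poly \<Rightarrow> ('h::complex_hilbert_space \<Rightarrow>\<^sub>L 'h) \<Rightarrow> ('h \<Rightarrow>\<^sub>L 'h)"
  where "poly_op p T = (\<Sum>i\<le>degree p. coeff p i *\<^sub>R op_power T i)"

text \<open>
  The continuous functional calculus of a self-adjoint operator \<open>T\<close>, for real-valued \<open>g\<close> continuous
  on the spectrum of \<open>T\<close> (a compact subset of the real line): the continuous extension of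
  \<open>p \<mapsto> p(T)\<close> from polynomials. Thus \<open>g(T)\<close> is the limit in operator norm of \<open>p\<^sub>n(T)\<close> for any
  polynomials \<open>p\<^sub>n\<close> converging to \<open>g\<close> uniformly on the spectrum. Such sequences exist by the
  Weierstrass theorem, and the limit exists and does not depend on the sequence because the norm of
  \<open>p(T)\<close> is the supremum of \<open>\<bar>p\<bar>\<close> on the spectrum.
\<close>

definition functional_calculus ::
    "(real \<Rightarrow> real) \<Rightarrow> ('h::complex_hilbert_space \<Rightarrow>\<^sub>L 'h) \<Rightarrow> ('h \<Rightarrow>\<^sub>L 'h)"
  where "functional_calculus g T =
    (THE S. \<forall>p :: nat \<Rightarrow> real poly.
        uniform_limit {t. complex_of_real t \<in> op_spectrum T} (\<lambda>n. poly (p n)) g sequentially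
          \<longrightarrow> (\<lambda>n. poly_op (p n) T) \<longlonglongrightarrow> S)"

text \<open>
  The maximum and minimum of functions continuous on \<open>[a, b]\<close> are their supremum and infimum. The
  quotient is taken in the extended reals, because \<open>g\<close> may vanish somewhere: then it is \<open>\<infinity>\<close> when the
  maximum of \<open>f\<close> is positive (real division by zero would make it \<open>0\<close>). In the extended reals
  \<open>0 / 0 = 0\<close> and \<open>\<infinity> * 0 = 0\<close>.
\<close>

definition M_ratio :: "real \<Rightarrow> real \<Rightarrow> (real \<Rightarrow> real) \<Rightarrow> (real \<Rightarrow> real) \<Rightarrow> ereal"
  where "M_ratio a b f g = ereal (SUP x\<in>{a..b}. f x) / ereal (INF x\<in>{a..b}. g x)"

lemma M_ratio_eq_real:
  assumes "(INF x\<in>{a..b}. g x) \<noteq> 0"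
  shows "M_ratio a b f g = ereal ((SUP x\<in>{a..b}. f x) / (INF x\<in>{a..b}. g x))"
  using assms by (simp add: M_ratio_def)

end

theory Submission
  imports Defs "HOL-Computational_Algebra.Fundamental_Theorem_Algebra"
begin

text \<open>
  Put \<open>m = min g\<close> and \<open>M = max f\<close>. Since \<open>\<langle>g(A)h, h\<rangle> \<ge> m\<close> and \<open>f \<le> M\<close>, for \<open>m > 0\<close> the ratio
  condition gives \<open>(f b - f a) \<langle>g(A)h, h\<rangle> \<ge> (M / m) (g b - g a) m \<ge> (g b - g a) f(\<langle>Ah, h\<rangle>)\<close>;
  for \<open>m = 0\<close> it forces \<open>g b = g a\<close>.

  The functional calculus rests on one fact: a real polynomial \<open>p\<close> that is nonnegative on the
  spectrum of a self-adjoint \<open>T\<close> gives \<open>p(T) \<ge> 0\<close>. If the infimum \<open>\<mu>\<close> of the quadratic form of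
  \<open>p(T)\<close> were negative, then \<open>p - \<mu>\<close> would have no zero on the spectrum, so \<open>p(T) - \<mu>\<close> would be
  bounded below (factor \<open>p - \<mu>\<close> into linear and quadratic factors), whereas \<open>\<mu>\<close> is an approximate
  eigenvalue of \<open>p(T)\<close>. Applied to \<open>s\<^sup>2 - p\<^sup>2\<close>, the fact bounds the norm of \<open>p(T)\<close> by the
  supremum \<open>s\<close> of \<open>\<bar>p\<bar>\<close> on the spectrum.
\<close>

section \<open>The real part of the inner product\<close>

abbreviation rinner :: "'h::complex_hilbert_space \<Rightarrow> 'h \<Rightarrow> real"
  where "rinner x y \<equiv> Re (cinner x y)"

lemma rinner_commute: "rinner x y = rinner y x"
  by (subst cinner_commute) simp

lemma rinner_add_left: "rinner (x + y) z = rinner x z + rinner y z"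
  by (simp add: cinner_add_left)

lemma rinner_scaleR_left: "rinner (r *\<^sub>R x) y = r * rinner x y"
  using cinner_scaleC_left[of "complex_of_real r" x y] by (simp add: scaleC_of_real)

lemma rinner_minus_left: "rinner (- x) y = - rinner x y"
  using rinner_scaleR_left[of "-1" x y] by simp

lemma rinner_diff_left: "rinner (x - y) z = rinner x z - rinner y z"
  using rinner_add_left[of x "- y" z] by (simp add: rinner_minus_left)

lemma rinner_add_right: "rinner z (x + y) = rinner z x + rinner z y"
  using rinner_add_left[of x y z] by (metis rinner_commute)

lemma rinner_diff_right: "rinner z (x - y) = rinner z x - rinner z y"
  using rinner_diff_left[of x y z] by (metis rinner_commute)

lemma rinner_scaleR_right: "rinner x (r *\<^sub>R y) = r * rinner x y"
  using rinner_scaleR_left[of r y x] by (metis rinner_commute)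

lemma rinner_self: "rinner x x = (norm x)\<^sup>2"
  by (simp add: cinner_self del: of_real_power)

lemmas rinner_simps = rinner_add_left rinner_add_right rinner_diff_left rinner_diff_right
  rinner_minus_left rinner_scaleR_left rinner_scaleR_right rinner_self

lemma rinner_zero_left [simp]: "rinner 0 y = 0"
  using rinner_scaleR_left[of 0 y y] by simp

lemma rinner_zero_right [simp]: "rinner x 0 = 0"
  using rinner_scaleR_right[of x 0 x] by simp

text \<open>Cauchy-Schwarz, read off from the nonnegative square norm of
  \<open>norm y *\<^sub>R x - norm x *\<^sub>R y\<close>.\<close>

lemma rinner_le_norm: "rinner x y \<le> norm x * norm y"
proof (cases "x = 0 \<or> y = 0")
  case False
  define s where "s = norm x * norm y"
  have "s > 0" using False by (simp add: s_def)
  have "0 \<le> rinner (norm y *\<^sub>R x - norm x *\<^sub>R y) (norm y *\<^sub>R x - norm x *\<^sub>R y)"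
    unfolding rinner_self by simp
  also have "\<dots> = 2 * s * (s - rinner x y)"
    unfolding rinner_diff_left rinner_diff_right rinner_scaleR_left rinner_scaleR_right
      rinner_commute[of y x]
    by (simp add: s_def rinner_self algebra_simps power2_eq_square)
  finally show ?thesis
    using \<open>s > 0\<close> by (simp add: zero_le_mult_iff s_def)
qed auto

lemma abs_rinner_le_norm: "\<bar>rinner x y\<bar> \<le> norm x * norm y"
  using rinner_le_norm[of x y] rinner_le_norm[of "- x" y] by (simp add: rinner_minus_left)

text \<open>Polarization expresses the form through norms, whose continuity is known.\<close>

lemma tendsto_rinner_left:
  fixes u :: "'a \<Rightarrow> 'h::complex_hilbert_space"
  assumes "(u \<longlongrightarrow> x) F"
  shows "((\<lambda>n. rinner (u n) y) \<longlongrightarrow> rinner x y) F"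
proof -
  have polarization: "rinner x y = ((norm (x + y))\<^sup>2 - (norm x)\<^sup>2 - (norm y)\<^sup>2) / 2" for x y :: 'h
    unfolding rinner_self[symmetric] rinner_add_left rinner_add_right
    by (simp add: rinner_commute[of y x])
  show ?thesis
    unfolding polarization by (intro tendsto_intros assms) simp
qed

lemma self_adjoint_rinner:
  "self_adjoint T \<Longrightarrow> rinner (T x) y = rinner x (T y)"
  by (simp add: self_adjoint_def)

section \<open>Polynomials in an operator\<close>

lemma op_power_0: "op_power T 0 = id_blinfun"
  by (simp add: op_power_def)

lemma op_power_Suc: "op_power T (Suc n) = T o\<^sub>L op_power T n"
  by (simp add: op_power_def)

text \<open>Lets sums over polynomials of different degrees run over a common range; the additional
  coefficients vanish.\<close>

lemma poly_op_apply_atMost: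
  assumes "degree p \<le> N"
  shows "poly_op p T x = (\<Sum>i\<le>N. coeff p i *\<^sub>R op_power T i x)"
proof -
  have "poly_op p T x = (\<Sum>i\<le>degree p. coeff p i *\<^sub>R op_power T i x)"
    by (simp add: poly_op_def blinfun.sum_left blinfun.scaleR_left)
  also have "\<dots> = (\<Sum>i\<le>N. coeff p i *\<^sub>R op_power T i x)"
    using assms by (intro sum.mono_neutral_left) (auto simp: coeff_eq_0)
  finally show ?thesis .
qed

lemma poly_op_0 [simp]: "poly_op 0 T = 0"
  by (simp add: poly_op_def)

lemma poly_op_add: "poly_op (p + q) T = poly_op p T + poly_op q T"
proof (rule blinfun_eqI)
  fix x
  let ?N = "max (degree p) (degree q)"
  show "poly_op (p + q) T x = (poly_op p T + poly_op q T) x"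
    unfolding blinfun.add_left
    by (subst (1 2 3) poly_op_apply_atMost[where N = ?N])
      (auto simp: degree_add_le_max scaleR_add_left sum.distrib)
qed

lemma poly_op_smult: "poly_op (smult c p) T = c *\<^sub>R poly_op p T"
proof (rule blinfun_eqI)
  fix x
  show "poly_op (smult c p) T x = (c *\<^sub>R poly_op p T) x"
    unfolding blinfun.scaleR_left
    by (subst (1 2) poly_op_apply_atMost[where N = "degree p"])
      (auto simp: degree_smult_le scaleR_sum_right)
qed

lemma poly_op_diff: "poly_op (p - q) T = poly_op p T - poly_op q T"
  using poly_op_add[of p "smult (-1) q" T] poly_op_smult[of "-1" q T] by simp

text \<open>One step of Horner's scheme, which opens \<open>poly_op\<close> to induction over
  \<open>pCons\<close>.\<close>

lemma poly_op_pCons: "poly_op (pCons c p) T = c *\<^sub>R id_blinfun + (T o\<^sub>L poly_op p T)"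
proof (rule blinfun_eqI)
  fix x
  show "poly_op (pCons c p) T x = (c *\<^sub>R id_blinfun + (T o\<^sub>L poly_op p T)) x"
    unfolding blinfun.add_left blinfun.scaleR_left blinfun_apply_blinfun_compose
    by (subst (1) poly_op_apply_atMost[where N = "Suc (degree p)"],
        simp add: degree_pCons_le, subst poly_op_apply_atMost[OF order_refl])
      (simp add: sum.atMost_Suc_shift op_power_0 op_power_Suc blinfun.sum_right
        blinfun.scaleR_right del: sum.atMost_Suc)
qed

lemma poly_op_const: "poly_op [:c:] T = c *\<^sub>R id_blinfun"
  by (rule blinfun_eqI) (simp add: poly_op_pCons blinfun.add_left blinfun.zero_right)

lemma poly_op_linear: "poly_op [:- t, 1:] T x = T x - t *\<^sub>R x"
  by (simp add: poly_op_pCons blinfun.add_left blinfun.scaleR_left blinfun.diff_left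
      blinfun.minus_left blinfun.add_right blinfun.zero_right)

lemma poly_op_mult: "poly_op (p * q) T = poly_op p T o\<^sub>L poly_op q T"
  by (induction p)
    (auto intro!: blinfun_eqI simp: poly_op_pCons poly_op_add poly_op_smult blinfun.add_left
      blinfun.scaleR_left blinfun.zero_left)

text \<open>Both sides come from the product of \<open>p\<close> and the identity polynomial, and
  polynomial multiplication commutes.\<close>

lemma poly_op_commute: "poly_op p T (T x) = T (poly_op p T x)"
proof -
  have X: "poly_op [:0, 1:] T = T"
    by (rule blinfun_eqI) (use poly_op_linear[of 0 T] in simp)
  show ?thesis
    using poly_op_mult[of p "[:0, 1:]" T] poly_op_mult[of "[:0, 1:]" p T]
    unfolding X by (metis blinfun_apply_blinfun_compose mult.commute)
qed

lemma rinner_poly_op: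
  assumes "self_adjoint T"
  shows "rinner (poly_op p T x) y = rinner x (poly_op p T y)"
proof (induction p arbitrary: x y)
  case (pCons c p)
  have "rinner (T (poly_op p T x)) y = rinner x (T (poly_op p T y))"
    by (simp add: self_adjoint_rinner[OF assms] pCons.IH poly_op_commute)
  then show ?case
    by (simp add: poly_op_pCons blinfun.add_left blinfun.scaleR_left rinner_simps
        del: plus_complex.sel minus_complex.sel)
qed (simp add: blinfun.zero_left)

section \<open>Polynomials that are nonnegative on the spectrum\<close>

abbreviation real_spectrum :: "('h::complex_hilbert_space \<Rightarrow>\<^sub>L 'h) \<Rightarrow> real set"
  where "real_spectrum T \<equiv> {t. complex_of_real t \<in> op_spectrum T}"

text \<open>Stands in for invertibility: it follows from a bounded left inverse, survives
  composition, and fails for \<open>B - m\<close> when \<open>m\<close> is the infimum of the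
  quadratic form of a symmetric \<open>B\<close> on unit vectors.\<close>

definition bounded_below :: "('h::complex_hilbert_space \<Rightarrow>\<^sub>L 'h) \<Rightarrow> bool"
  where "bounded_below T \<longleftrightarrow> (\<exists>c>0. \<forall>x. c * norm x \<le> norm (T x))"

lemma bounded_below_compose:
  assumes "bounded_below S" "bounded_below T"
  shows "bounded_below (S o\<^sub>L T)"
proof -
  obtain c d where c: "c > 0" "\<And>x. c * norm x \<le> norm (S x)"
    and d: "d > 0" "\<And>x. d * norm x \<le> norm (T x)"
    using assms by (auto simp: bounded_below_def)
  have "c * d * norm x \<le> norm (S (T x))" for x
    using order_trans[OF mult_left_mono[OF d(2)[of x], of c] c(2)[of "T x"]] c(1)
    by (simp add: mult.assoc)
  then show ?thesis
    using c(1) d(1) by (auto simp: bounded_below_def intro!: exI[of _ "c * d"])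
qed

lemma bounded_below_poly_op_linear:
  assumes "t \<notin> real_spectrum T"
  shows "bounded_below (poly_op [:- t, 1:] T)"
proof -
  obtain R :: "'a \<Rightarrow>\<^sub>L 'a" where R: "\<And>x. R (T x - complex_of_real t *\<^sub>C x) = x"
    using assms by (auto simp: op_spectrum_def)
  \<comment> \<open>The summand 1 keeps the constant positive even if \<open>R\<close> is zero, as
    on the zero space.\<close>
  have "norm x \<le> (norm R + 1) * norm (T x - t *\<^sub>R x)" for x
  proof -
    have "norm x = norm (R (T x - t *\<^sub>R x))"
      using R[of x] by (simp add: scaleC_of_real)
    also have "\<dots> \<le> norm R * norm (T x - t *\<^sub>R x)"
      by (rule norm_blinfun)
    also have "\<dots> \<le> (norm R + 1) * norm (T x - t *\<^sub>R x)"
      by (rule mult_right_mono) auto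
    finally show ?thesis .
  qed
  then have "1 / (norm R + 1) * norm x \<le> norm (poly_op [:- t, 1:] T x)" for x
    by (simp add: poly_op_linear pos_divide_le_eq add_nonneg_pos mult.commute)
  then show ?thesis
    unfolding bounded_below_def by (intro exI[of _ "1 / (norm R + 1)"]) (auto intro: add_nonneg_pos)
qed

lemma norm_le_if_coercive:
  fixes T :: "'h::complex_hilbert_space \<Rightarrow>\<^sub>L 'h"
  assumes "d > 0" "\<And>x. d * (norm x)\<^sup>2 \<le> rinner (T x) x"
  shows "d * norm x \<le> norm (T x)"
proof (cases "x = 0")
  case False
  have "d * norm x * norm x \<le> norm (T x) * norm x"
    using assms(2)[of x] rinner_le_norm[of "T x" x] by (simp add: power2_eq_square)
  then show ?thesis using False by simp
qed simp

text \<open>Completing the square gives \<open>(T - u)\<^sup>2 + v\<^sup>2\<close>; the first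
  summand has a nonnegative form since \<open>T\<close> is symmetric, so the whole is coercive with
  constant \<open>v\<^sup>2\<close>.\<close>

lemma bounded_below_poly_op_quadratic:
  assumes "self_adjoint T" "v \<noteq> 0"
  shows "bounded_below (poly_op [:u\<^sup>2 + v\<^sup>2, - 2 * u, 1:] T)"
proof -
  let ?L = "poly_op [:- u, 1:] T"
  have eq: "[:u\<^sup>2 + v\<^sup>2, - 2 * u, 1:] = [:- u, 1:] * [:- u, 1:] + [:v\<^sup>2:]"
    by (simp add: power2_eq_square)
  have "rinner (poly_op [:u\<^sup>2 + v\<^sup>2, - 2 * u, 1:] T x) x = (norm (?L x))\<^sup>2 + v\<^sup>2 * (norm x)\<^sup>2" for x
    unfolding eq poly_op_add poly_op_mult poly_op_const
    by (simp add: blinfun.add_left blinfun.scaleR_left rinner_add_left rinner_scaleR_left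
        rinner_poly_op[OF assms(1)] rinner_self del: plus_complex.sel)
  then have "v\<^sup>2 * (norm x)\<^sup>2 \<le> rinner (poly_op [:u\<^sup>2 + v\<^sup>2, - 2 * u, 1:] T x) x" for x
    by simp
  then show ?thesis
    using norm_le_if_coercive[of "v\<^sup>2"] assms(2) unfolding bounded_below_def
    by (metis zero_less_power2)
qed

text \<open>This and the next two lemmas make evaluation of the complexified polynomial at
  \<open>z\<close> compatible with the ring operations, so that a complex root can be carried
  through division with remainder over the reals.\<close>

lemma poly_map_poly_of_real_add:
  "poly (map_poly complex_of_real (p + q)) z
    = poly (map_poly complex_of_real p) z + poly (map_poly complex_of_real q) z"
  by (induction p q rule: poly_induct2) (simp_all add: map_poly_pCons algebra_simps)

lemma poly_map_poly_of_real_smult: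
  "poly (map_poly complex_of_real (smult c p)) z = c * poly (map_poly complex_of_real p) z"
  by (induction p) (simp_all add: map_poly_pCons algebra_simps)

lemma poly_map_poly_of_real_mult:
  "poly (map_poly complex_of_real (p * q)) z
    = poly (map_poly complex_of_real p) z * poly (map_poly complex_of_real q) z"
  by (induction p)
    (simp_all add: poly_map_poly_of_real_add poly_map_poly_of_real_smult map_poly_pCons
      algebra_simps)

lemma poly_map_poly_of_real_of_real:
  "poly (map_poly complex_of_real p) (complex_of_real t) = complex_of_real (poly p t)"
  by (induction p) (simp_all add: map_poly_pCons)

text \<open>
  The remainder of the division is a real polynomial of degree at most one that vanishes at the
  nonreal number \<open>z\<close>, hence is zero.
\<close>

lemma quadratic_dvd_of_nonreal_root:
  fixes p :: "real poly"
  assumes root: "poly (map_poly complex_of_real p) z = 0" and "Im z \<noteq> 0"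
  shows "[:(Re z)\<^sup>2 + (Im z)\<^sup>2, - 2 * Re z, 1:] dvd p"
proof -
  let ?q = "[:(Re z)\<^sup>2 + (Im z)\<^sup>2, - 2 * Re z, 1:]"
  define r where "r = p mod ?q"
  have "degree r \<le> 1"
    using degree_mod_less[of ?q p] by (auto simp: r_def)
  then obtain c d where r: "r = [:c, d:]"
    by (metis One_nat_def degree_0 degree_eq_zeroE degree_pCons_eq_if le_zero_eq not_less_eq_eq
        pCons_cases)
  have "poly (map_poly complex_of_real ?q) z = 0"
    by (simp add: map_poly_pCons complex_eq_iff power2_eq_square algebra_simps)
  moreover have "p = ?q * (p div ?q) + r"
    unfolding r_def by (rule mult_div_mod_eq[symmetric])
  ultimately have "poly (map_poly complex_of_real r) z = 0"
    using root by (metis add_0 mult_zero_left poly_map_poly_of_real_add poly_map_poly_of_real_mult)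
  then have "c = 0 \<and> d = 0"
    using \<open>Im z \<noteq> 0\<close> by (auto simp: r map_poly_pCons complex_eq_iff)
  then show ?thesis
    using r by (auto simp: r_def mod_eq_0_iff_dvd)
qed

text \<open>Induction on the degree: a complex root yields a real factor, linear if the root is real
  and quadratic otherwise. A real root lies off the spectrum by hypothesis, so either factor is
  bounded below, and the quotient again has no zero on the spectrum.\<close>

lemma bounded_below_poly_op:
  assumes "self_adjoint T" "p \<noteq> 0" "\<And>t. t \<in> real_spectrum T \<Longrightarrow> poly p t \<noteq> 0"
  shows "bounded_below (poly_op p T)"
  using assms(2,3)
proof (induction "degree p" arbitrary: p rule: less_induct)
  case less
  show ?case
  proof (cases "degree p = 0")
    case True
    then obtain c where c: "p = [:c:]"
      by (metis degree_eq_zeroE)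
    then have "c \<noteq> 0" using less.prems(1) by auto
    then show ?thesis
      by (auto simp: c poly_op_const bounded_below_def blinfun.scaleR_left intro!: exI[of _ "\<bar>c\<bar>"])
  next
    case False
    then obtain z where z: "poly (map_poly complex_of_real p) z = 0"
      using fundamental_theorem_of_algebra_alt[of "map_poly complex_of_real p"]
      by (metis degree_pCons_0 degree_map_poly of_real_eq_0_iff)
    have factor: ?thesis
      if q: "q dvd p" "degree q > 0" "bounded_below (poly_op q T)" for q
    proof -
      obtain r where r: "p = q * r" using q(1) by (auto elim: dvdE)
      have "r \<noteq> 0" "q \<noteq> 0" using r less.prems(1) by auto
      then have "degree r < degree p" using q(2) by (simp add: r degree_mult_eq)
      then have "bounded_below (poly_op r T)"
        using less.hyps[of r] \<open>r \<noteq> 0\<close> less.prems(2) by (auto simp: r)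
      then show ?thesis
        using q(3) by (simp add: r poly_op_mult bounded_below_compose)
    qed
    show ?thesis
    proof (cases "Im z = 0")
      case True
      then have "z = complex_of_real (Re z)" by (simp add: complex_eq_iff)
      then have "poly p (Re z) = 0"
        using z by (metis of_real_eq_0_iff poly_map_poly_of_real_of_real)
      then show ?thesis
        using factor[of "[:- Re z, 1:]"] bounded_below_poly_op_linear[of "Re z" T] less.prems(2)
        by (auto simp: poly_eq_0_iff_dvd)
    next
      case False
      then show ?thesis
        using factor[OF quadratic_dvd_of_nonreal_root[OF z False]]
          bounded_below_poly_op_quadratic[OF assms(1) False, of "Re z"] by simp
    qed
  qed
qed

text \<open>A small value of a nonnegative form forces \<open>C x\<close> to be small. The bound is
  nonnegativity of the form at \<open>K *\<^sub>R x - C x\<close>, divided by the positive number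
  \<open>K = norm C + 1\<close>.\<close>

lemma norm_power2_le_of_nonneg:
  fixes C :: "'h::complex_hilbert_space \<Rightarrow>\<^sub>L 'h"
  assumes sym: "\<And>x y. rinner (C x) y = rinner x (C y)"
    and nonneg: "\<And>x. 0 \<le> rinner (C x) x"
  shows "(norm (C x))\<^sup>2 \<le> (norm C + 1) * rinner (C x) x"
proof -
  define K where "K = norm C + 1"
  have "K > 0" by (simp add: K_def add_nonneg_pos)
  have "rinner (C (C x)) (C x) \<le> norm (C (C x)) * norm (C x)"
    by (rule rinner_le_norm)
  also have "\<dots> \<le> (norm C * norm (C x)) * norm (C x)"
    by (intro mult_right_mono norm_blinfun) auto
  also have "\<dots> \<le> K * (norm (C x))\<^sup>2"
    by (simp add: K_def power2_eq_square algebra_simps)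
  finally have le: "rinner (C (C x)) (C x) \<le> K * (norm (C x))\<^sup>2" .
  have "0 \<le> rinner (C (K *\<^sub>R x - C x)) (K *\<^sub>R x - C x)"
    by (rule nonneg)
  also have "\<dots> = K\<^sup>2 * rinner (C x) x - 2 * K * (norm (C x))\<^sup>2 + rinner (C (C x)) (C x)"
    unfolding blinfun.diff_right blinfun.scaleR_right rinner_diff_left rinner_diff_right
      rinner_scaleR_left rinner_scaleR_right
    using sym[of "C x" x]
    by (simp add: rinner_self power2_eq_square algebra_simps)
  also have "\<dots> \<le> K * (K * rinner (C x) x - (norm (C x))\<^sup>2)"
    using le by (simp add: power2_eq_square algebra_simps)
  finally show ?thesis
    using \<open>K > 0\<close> by (simp add: zero_le_mult_iff K_def)
qed

text \<open>With \<open>m\<close> the infimum of the form of \<open>B\<close> over unit vectors,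
  \<open>C = B - m\<close> has a nonnegative form. If \<open>C\<close> were bounded below by
  \<open>c\<close>, the preceding lemma would lift every value of the form to at least
  \<open>m + c\<^sup>2 / K\<close>, against the choice of \<open>m\<close>.\<close>

lemma not_bounded_below_numerical_inf:
  fixes B :: "'h::complex_hilbert_space \<Rightarrow>\<^sub>L 'h"
  assumes sym: "\<And>x y. rinner (B x) y = rinner x (B y)" and "norm (e :: 'h) = 1"
  obtains m where "m \<le> rinner (B e) e" and "\<not> bounded_below (B - m *\<^sub>R id_blinfun)"
proof
  define N where "N = {rinner (B x) x | x. norm x = 1}"
  define m where "m = Inf N"
  define C where "C = B - m *\<^sub>R id_blinfun"
  have C: "rinner (C x) y = rinner (B x) y - m * rinner x y"
      "rinner y (C x) = rinner y (B x) - m * rinner y x" for x y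
    unfolding C_def blinfun.diff_left blinfun.scaleR_left rinner_simps by simp_all
  have "N \<noteq> {}" using assms(2) by (auto simp: N_def)
  have bdd: "bdd_below N"
  proof
    fix t assume "t \<in> N"
    then obtain x where x: "t = rinner (B x) x" "norm x = 1" by (auto simp: N_def)
    show "- norm B \<le> t"
      using abs_rinner_le_norm[of "B x" x] norm_blinfun[of B x] x by simp
  qed
  have m_le: "m \<le> rinner (B x) x" if "norm x = 1" for x
    unfolding m_def by (rule cInf_lower[OF _ bdd]) (use that in \<open>auto simp: N_def\<close>)
  then show "m \<le> rinner (B e) e" using assms(2) .
  \<comment> \<open>The infimum only sees unit vectors; homogeneity extends the bound to all
    \<open>x\<close>.\<close>
  have nonneg: "0 \<le> rinner (C x) x" for x
  proof (cases "x = 0")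
    case False
    define y where "y = (1 / norm x) *\<^sub>R x"
    have "norm y = 1" "x = norm x *\<^sub>R y" using False by (simp_all add: y_def)
    moreover have "0 \<le> rinner (C y) y"
      using m_le[OF \<open>norm y = 1\<close>] by (simp add: C(1) rinner_self \<open>norm y = 1\<close>)
    ultimately show ?thesis
      by (metis blinfun.scaleR_right rinner_scaleR_left rinner_scaleR_right norm_ge_zero
          mult_nonneg_nonneg)
  qed simp
  have C_sym: "rinner (C x) y = rinner x (C y)" for x y
    by (simp add: C sym)
  show "\<not> bounded_below (B - m *\<^sub>R id_blinfun)"
  proof
    assume "bounded_below (B - m *\<^sub>R id_blinfun)"
    then obtain c where c: "c > 0" "\<And>x. c * norm x \<le> norm (C x)"
      by (auto simp: bounded_below_def C_def)
    define K where "K = norm C + 1"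
    have "K > 0" by (simp add: K_def add_nonneg_pos)
    have "m + c\<^sup>2 / K \<le> Inf N"
    proof (rule cInf_greatest[OF \<open>N \<noteq> {}\<close>])
      fix t assume "t \<in> N"
      then obtain x where x: "t = rinner (B x) x" "norm x = 1" by (auto simp: N_def)
      have "c\<^sup>2 \<le> (norm (C x))\<^sup>2"
        using c(1) c(2)[of x] x(2) by (intro power_mono) auto
      also have "\<dots> \<le> K * rinner (C x) x"
        unfolding K_def by (rule norm_power2_le_of_nonneg[OF C_sym nonneg])
      also have "rinner (C x) x = t - m"
        by (simp add: C x rinner_self)
      finally show "m + c\<^sup>2 / K \<le> t"
        using \<open>K > 0\<close> by (simp add: field_simps)
    qed
    moreover have "c\<^sup>2 / K > 0" using c(1) \<open>K > 0\<close> by simp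
    ultimately show False by (simp add: m_def)
  qed
qed

text \<open>The infimum of the quadratic form of \<open>T\<close> is itself a spectral point,
  because \<open>T - m\<close> is not bounded below there.\<close>

lemma real_spectrum_nonempty:
  fixes e :: "'h::complex_hilbert_space"
  assumes "self_adjoint T" "norm e = 1"
  shows "real_spectrum (T :: 'h \<Rightarrow>\<^sub>L 'h) \<noteq> {}"
proof -
  obtain m where "\<not> bounded_below (T - m *\<^sub>R id_blinfun)"
    using not_bounded_below_numerical_inf[OF self_adjoint_rinner[OF assms(1)] assms(2)] by metis
  moreover have "T - m *\<^sub>R id_blinfun = poly_op [:- m, 1:] T"
    by (rule blinfun_eqI) (simp add: poly_op_linear blinfun.diff_left blinfun.scaleR_left)
  ultimately show ?thesis
    using bounded_below_poly_op_linear[of m T] by auto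
qed

lemma rinner_poly_op_nonneg:
  fixes T :: "'h::complex_hilbert_space \<Rightarrow>\<^sub>L 'h"
  assumes T: "self_adjoint T" and p: "\<And>t. t \<in> real_spectrum T \<Longrightarrow> 0 \<le> poly p t"
  shows "0 \<le> rinner (poly_op p T x) x"
proof (rule ccontr)
  assume neg: "\<not> 0 \<le> rinner (poly_op p T x) x"
  define e where "e = (1 / norm x) *\<^sub>R x"
  have "x \<noteq> 0" using neg by auto
  then have e: "norm e = 1" by (simp add: e_def)
  have "rinner (poly_op p T e) e = (1 / norm x) * ((1 / norm x) * rinner (poly_op p T x) x)"
    unfolding e_def blinfun.scaleR_right rinner_scaleR_left rinner_scaleR_right ..
  also have "\<dots> < 0" using neg \<open>x \<noteq> 0\<close> by (simp add: mult_pos_neg divide_neg_pos)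
  finally obtain m where m: "m < 0" "\<not> bounded_below (poly_op p T - m *\<^sub>R id_blinfun)"
    using not_bounded_below_numerical_inf[OF rinner_poly_op[OF T] e] by (metis order_le_less_trans)
  have pos: "poly (p - [:m:]) t > 0" if "t \<in> real_spectrum T" for t
    using p[OF that] m(1) by simp
  \<comment> \<open>Positivity on the spectrum excludes the zero polynomial only because the
    spectrum has a point.\<close>
  have "p - [:m:] \<noteq> 0"
    using pos real_spectrum_nonempty[OF T e] by force
  then have "bounded_below (poly_op (p - [:m:]) T)"
    using pos by (intro bounded_below_poly_op[OF T]) force+
  then show False
    using m(2) by (simp add: poly_op_diff poly_op_const)
qed

text \<open>On the zero space the spectrum is empty, so \<open>0 \<le> s\<close> has to be required
  separately.\<close>

lemma norm_poly_op_le: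
  assumes T: "self_adjoint T" and "0 \<le> s"
    and p: "\<And>t. t \<in> real_spectrum T \<Longrightarrow> \<bar>poly p t\<bar> \<le> s"
  shows "norm (poly_op p T) \<le> s"
proof (rule norm_blinfun_bound[OF \<open>0 \<le> s\<close>])
  fix x
  have "0 \<le> poly ([:s\<^sup>2:] - p * p) t" if "t \<in> real_spectrum T" for t
    using power_mono[OF p[OF that], of 2] by (simp add: power2_eq_square)
  then have "0 \<le> rinner (poly_op ([:s\<^sup>2:] - p * p) T x) x"
    by (rule rinner_poly_op_nonneg[OF T])
  also have "\<dots> = s\<^sup>2 * (norm x)\<^sup>2 - (norm (poly_op p T x))\<^sup>2"
    unfolding poly_op_diff poly_op_mult poly_op_const blinfun.diff_left blinfun.scaleR_left
      blinfun_apply_blinfun_compose rinner_diff_left rinner_scaleR_left rinner_poly_op[OF T, of p "poly_op p T x"]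
    by (simp add: rinner_self)
  finally have "(norm (poly_op p T x))\<^sup>2 \<le> (s * norm x)\<^sup>2"
    by (simp add: power_mult_distrib)
  then show "norm (poly_op p T x) \<le> s * norm x"
    by (rule power2_le_imp_le) (simp add: \<open>0 \<le> s\<close>)
qed

section \<open>Location of the spectrum\<close>

text \<open>For small \<open>s > 0\<close> the map \<open>x \<mapsto> x - s (C x - y)\<close> is a contraction.\<close>

lemma coercive_surj:
  fixes C :: "'h::complex_hilbert_space \<Rightarrow>\<^sub>L 'h"
  assumes "d > 0" and coercive: "\<And>x. d * (norm x)\<^sup>2 \<le> rinner (C x) x"
  shows "\<exists>x. C x = y"
proof -
  define K where "K = norm C + d"
  \<comment> \<open>This \<open>s\<close> minimizes the bound
    \<open>1 - 2 * s * d + s\<^sup>2 * K\<^sup>2\<close> for the squared Lipschitz constant of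
    \<open>F\<close>. The minimum is \<open>1 - d * s\<close>, nonnegative because
    \<open>d \<le> K\<close>.\<close>
  define s where "s = d / K\<^sup>2"
  define c where "c = sqrt (1 - d * s)"
  define F where "F x = x - s *\<^sub>R (C x - y)" for x
  have K: "K > 0" "d \<le> K" using \<open>d > 0\<close> by (simp_all add: K_def add_nonneg_pos)
  have s: "s > 0" "s * K\<^sup>2 = d" using K \<open>d > 0\<close> by (simp_all add: s_def)
  have "d\<^sup>2 \<le> K\<^sup>2" using K \<open>d > 0\<close> by (intro power_mono) auto
  then have "d * s \<le> 1" using K by (simp add: s_def power2_eq_square)
  have contr: "dist (F x) (F z) \<le> c * dist x z" for x z
  proof -
    define w where "w = x - z"
    have "norm (C w) \<le> K * norm w"
      using norm_blinfun[of C w] mult_right_mono[of "norm C" K "norm w"] \<open>d > 0\<close>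
      by (simp add: K_def)
    then have CK: "(norm (C w))\<^sup>2 \<le> K\<^sup>2 * (norm w)\<^sup>2"
      using power_mono[of "norm (C w)" "K * norm w" 2] by (simp add: power_mult_distrib)
    have "F x - F z = w - s *\<^sub>R C w"
      by (simp add: F_def w_def blinfun.diff_right algebra_simps)
    then have "(norm (F x - F z))\<^sup>2 = rinner (w - s *\<^sub>R C w) (w - s *\<^sub>R C w)"
      by (simp add: rinner_self)
    also have "\<dots> = (norm w)\<^sup>2 - 2 * s * rinner (C w) w + s * (s * (norm (C w))\<^sup>2)"
      unfolding rinner_diff_left rinner_diff_right rinner_scaleR_left rinner_scaleR_right
        rinner_commute[of w "C w"] by (simp add: rinner_self algebra_simps)
    also have "\<dots> \<le> (norm w)\<^sup>2 - 2 * s * (d * (norm w)\<^sup>2) + s * (s * (K\<^sup>2 * (norm w)\<^sup>2))"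
      using coercive[of w] CK s(1) by (intro add_mono diff_mono mult_left_mono) auto
    also have "\<dots> = (1 - d * s) * (norm w)\<^sup>2"
      using s(2) by (simp add: algebra_simps flip: mult.assoc[of s "K\<^sup>2"])
    also have "\<dots> = (c * norm w)\<^sup>2"
      using \<open>d * s \<le> 1\<close> by (simp add: c_def power_mult_distrib)
    finally have "norm (F x - F z) \<le> c * norm w"
      by (rule power2_le_imp_le) (use \<open>d * s \<le> 1\<close> in \<open>simp add: c_def\<close>)
    then show ?thesis by (simp add: dist_norm w_def)
  qed
  have "0 \<le> c" "c < 1" using \<open>d * s \<le> 1\<close> \<open>d > 0\<close> s(1) by (simp_all add: c_def)
  then have "\<exists>!x\<in>UNIV. F x = x"
    using contr by (intro Banach_fix) (auto simp: complete_UNIV)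
  then obtain x where "F x = x" by auto
  then show ?thesis using s(1) by (auto simp: F_def)
qed

text \<open>Surjectivity supplies a right inverse. The lower bound on \<open>norm (C x)\<close>
  makes \<open>C\<close> injective, whence the inverse is two-sided and linear, and bounds the
  inverse by \<open>1 / d\<close>.\<close>

lemma coercive_inverse:
  fixes C :: "'h::complex_hilbert_space \<Rightarrow>\<^sub>L 'h"
  assumes lin: "complex_linear C" and "d > 0"
    and coercive: "\<And>x. d * (norm x)\<^sup>2 \<le> rinner (C x) x"
  shows "\<exists>R :: 'h \<Rightarrow>\<^sub>L 'h. complex_linear R \<and> (\<forall>x. R (C x) = x \<and> C (R x) = x)"
proof -
  note below = norm_le_if_coercive[OF assms(2,3)]
  have inj: "x = z" if "C x = C z" for x z
    using below[of "x - z"] that \<open>d > 0\<close> by (simp add: blinfun.diff_right mult_le_0_iff)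
  obtain r where r: "\<And>y. C (r y) = y"
    using coercive_surj[OF assms(2,3)] by metis
  have "bounded_linear r"
  proof (rule bounded_linear_intro)
    show "r (x + y) = r x + r y" for x y
      by (rule inj) (simp add: blinfun.add_right r)
    show "r (t *\<^sub>R x) = t *\<^sub>R r x" for t x
      by (rule inj) (simp add: blinfun.scaleR_right r)
    show "norm (r x) \<le> norm x * (1 / d)" for x
      using below[of "r x"] \<open>d > 0\<close> by (simp add: r field_simps)
  qed
  then have R: "blinfun_apply (Blinfun r) = r" by (rule bounded_linear_Blinfun_apply)
  have "r (c *\<^sub>C x) = c *\<^sub>C r x" for c x
    by (rule inj) (use lin in \<open>simp add: complex_linear_def r\<close>)
  moreover have "r (C x) = x" for x
    by (rule inj) (simp add: r)
  ultimately show ?thesis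
    by (intro exI[of _ "Blinfun r"]) (simp add: complex_linear_def R r)
qed

text \<open>For \<open>t < a\<close> the operator \<open>A - t\<close> is coercive with constant
  \<open>a - t\<close>, for \<open>t > b\<close> the operator \<open>t - A\<close> with constant
  \<open>t - b\<close>; a coercive operator has an inverse, which a spectral point rules
  out.\<close>

lemma real_spectrum_subset:
  fixes A :: "'h::complex_hilbert_space \<Rightarrow>\<^sub>L 'h"
  assumes A: "self_adjoint A"
    and lower: "\<And>x. a * (norm x)\<^sup>2 \<le> rinner (A x) x"
    and upper: "\<And>x. rinner (A x) x \<le> b * (norm x)\<^sup>2"
  shows "real_spectrum A \<subseteq> {a..b}"
proof
  fix t assume "t \<in> real_spectrum A"
  have scale: "c *\<^sub>C t *\<^sub>R x = t *\<^sub>R c *\<^sub>C x" for c and x :: 'h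
    by (simp add: scaleC_scaleC mult.commute flip: scaleC_of_real)
  have scale_diff: "c *\<^sub>C (x - y) = c *\<^sub>C x - c *\<^sub>C y" for c and x y :: 'h
    using scaleC_add_right[of c "x - y" y] by (simp add: algebra_simps)
  have A_lin: "A (c *\<^sub>C x) = c *\<^sub>C A x" for c x
    using A by (simp add: self_adjoint_def complex_linear_def)
  let ?C = "A - t *\<^sub>R id_blinfun"
  have lin: "complex_linear ?C" "complex_linear (- ?C)"
    by (auto simp: complex_linear_def blinfun.diff_left blinfun.minus_left blinfun.scaleR_left
        A_lin scale scale_diff)
  have no_inverse: False
    if "complex_linear R" "\<And>x. R (?C x) = x \<and> ?C (R x) = x" for R
    using \<open>t \<in> real_spectrum A\<close> that
    by (auto simp: op_spectrum_def scaleC_of_real blinfun.diff_left blinfun.scaleR_left)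
  have C: "rinner (?C x) x = rinner (A x) x - t * (norm x)\<^sup>2" for x
    unfolding blinfun.diff_left blinfun.scaleR_left rinner_diff_left rinner_scaleR_left rinner_self
    by (simp add: rinner_self)
  have "a \<le> t"
  proof (rule ccontr)
    assume "\<not> a \<le> t"
    then show False
      using coercive_inverse[OF lin(1), of "a - t"] lower no_inverse
      by (auto simp: C algebra_simps simp del: minus_complex.sel)
  qed
  moreover have "t \<le> b"
  proof (rule ccontr)
    assume "\<not> t \<le> b"
    have "(t - b) * (norm x)\<^sup>2 \<le> rinner ((- ?C) x) x" for x
      using upper[of x] unfolding blinfun.minus_left rinner_minus_left C by (simp add: algebra_simps)
    then obtain R :: "'h \<Rightarrow>\<^sub>L 'h" where R: "complex_linear R"
        "\<And>x. R ((- ?C) x) = x \<and> (- ?C) (R x) = x"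
      using coercive_inverse[OF lin(2), of "t - b"] \<open>\<not> t \<le> b\<close> by auto
    have "complex_linear (- R)"
      using R(1) scale_diff[of _ 0 x for x] scale_diff[of _ 0 0] by (simp add: complex_linear_def blinfun.minus_left)
    moreover have "(- R) (?C x) = x \<and> ?C ((- R) x) = x" for x
      using R(2)[of x]
      by (simp only: blinfun.minus_left blinfun.minus_right minus_minus)
    ultimately show False by (rule no_inverse)
  qed
  ultimately show "t \<in> {a..b}" by simp
qed

section \<open>The functional calculus\<close>

lemma polynomial_approximation:
  fixes g :: "real \<Rightarrow> real"
  assumes "continuous_on {a..b} g"
  shows "\<exists>p :: nat \<Rightarrow> real poly. \<forall>n. \<forall>t\<in>{a..b}. \<bar>poly (p n) t - g t\<bar> < 1 / real (Suc n)"
proof -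
  have "\<exists>p :: real poly. \<forall>t\<in>{a..b}. \<bar>poly p t - g t\<bar> < 1 / real (Suc n)" for n
  proof -
    obtain q where q: "real_polynomial_function q" "\<And>t. t \<in> {a..b} \<Longrightarrow> \<bar>g t - q t\<bar> < 1 / real (Suc n)"
      using Stone_Weierstrass_real_polynomial_function[OF compact_Icc assms, of "1 / real (Suc n)"] by auto
    obtain c N where "q = (\<lambda>x. \<Sum>i\<le>N. c i * x ^ i)"
      using q(1) by (auto simp: real_polynomial_function_iff_sum)
    then have "poly (\<Sum>i\<le>N. monom (c i) i) t = q t" for t
      by (simp add: poly_sum poly_monom)
    then show ?thesis
      using q(2) by (metis abs_minus_commute)
  qed
  then show ?thesis by metis
qed

lemma norm_poly_op_diff_tendsto_0:
  assumes T: "self_adjoint T"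
    and "uniform_limit (real_spectrum T) (\<lambda>n. poly (p n)) g F"
    and "uniform_limit (real_spectrum T) (\<lambda>n. poly (q n)) g F"
  shows "((\<lambda>n. poly_op (p n) T - poly_op (q n) T) \<longlongrightarrow> 0) F"
proof (rule tendstoI)
  fix e :: real assume "e > 0"
  have "uniform_limit (real_spectrum T) (\<lambda>n t. poly (p n) t - poly (q n) t) (\<lambda>t. g t - g t) F"
    by (intro uniform_limit_intros assms)
  \<comment> \<open>Half of \<open>e\<close>, because the operator norm bound is not strict.\<close>
  then have "\<forall>\<^sub>F n in F. \<forall>t\<in>real_spectrum T. dist (poly (p n) t - poly (q n) t) (g t - g t) < e / 2"
    by (rule uniform_limitD) (use \<open>e > 0\<close> in simp)
  then show "\<forall>\<^sub>F n in F. dist (poly_op (p n) T - poly_op (q n) T) 0 < e"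
  proof eventually_elim
    case (elim n)
    then have "norm (poly_op (p n - q n) T) \<le> e / 2"
      using \<open>e > 0\<close> by (intro norm_poly_op_le[OF T]) (auto simp: dist_real_def intro!: less_imp_le)
    then show ?case using \<open>e > 0\<close> by (simp add: poly_op_diff)
  qed
qed

text \<open>Resolves the definite description. The norm bound makes \<open>poly_op (p n) T\<close>
  Cauchy, and the limit is shared by every other approximating sequence, since the differences tend
  to zero.\<close>

lemma functional_calculus_limit:
  assumes T: "self_adjoint T"
    and p: "uniform_limit (real_spectrum T) (\<lambda>n. poly (p n)) g sequentially"
  shows "(\<lambda>n. poly_op (p n) T) \<longlonglongrightarrow> functional_calculus g T"
proof -
  have "Cauchy (\<lambda>n. poly_op (p n) T)"
  proof (rule metric_CauchyI)
    fix e :: real assume "e > 0"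
    have "\<forall>\<^sub>F n in sequentially. \<forall>t\<in>real_spectrum T. dist (poly (p n) t) (g t) < e / 4"
      using p by (rule uniform_limitD) (use \<open>e > 0\<close> in simp)
    then obtain N where N: "\<And>n t. n \<ge> N \<Longrightarrow> t \<in> real_spectrum T \<Longrightarrow> \<bar>poly (p n) t - g t\<bar> < e / 4"
      by (auto simp: eventually_sequentially dist_real_def)
    show "\<exists>N. \<forall>m\<ge>N. \<forall>n\<ge>N. dist (poly_op (p m) T) (poly_op (p n) T) < e"
    proof (intro exI allI impI)
      fix m n assume "m \<ge> N" "n \<ge> N"
      have "norm (poly_op (p m - p n) T) \<le> e / 2"
      proof (rule norm_poly_op_le[OF T])
        fix t assume "t \<in> real_spectrum T"
        then show "\<bar>poly (p m - p n) t\<bar> \<le> e / 2"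
          using N[OF \<open>m \<ge> N\<close>, of t] N[OF \<open>n \<ge> N\<close>, of t] by (simp add: abs_if split: if_splits)
      qed (use \<open>e > 0\<close> in simp)
      then show "dist (poly_op (p m) T) (poly_op (p n) T) < e"
        using \<open>e > 0\<close> by (simp add: dist_norm poly_op_diff)
    qed
  qed
  then obtain S where S: "(\<lambda>n. poly_op (p n) T) \<longlonglongrightarrow> S"
    using Cauchy_convergent convergent_def by blast
  have "functional_calculus g T = S"
    unfolding functional_calculus_def
  proof (rule the_equality)
    show "\<forall>q. uniform_limit (real_spectrum T) (\<lambda>n. poly (q n)) g sequentially
        \<longrightarrow> (\<lambda>n. poly_op (q n) T) \<longlonglongrightarrow> S"
    proof (intro allI impI)
      fix q :: "nat \<Rightarrow> real poly"
      assume q: "uniform_limit (real_spectrum T) (\<lambda>n. poly (q n)) g sequentially"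
      show "(\<lambda>n. poly_op (q n) T) \<longlonglongrightarrow> S"
        using tendsto_add[OF norm_poly_op_diff_tendsto_0[OF T q p] S] by simp
    qed
  \<comment> \<open>Uniqueness needs an approximating sequence to exist: applied to
    \<open>p\<close>, any candidate is a limit of the same sequence as \<open>S\<close>.\<close>
  qed (use p S LIMSEQ_unique in blast)
  then show ?thesis using S by simp
qed

text \<open>Weierstrass approximants satisfy \<open>p n \<ge> m - 1 / (n + 1)\<close> on the
  spectrum, hence so do the forms of \<open>p n\<close> at \<open>A\<close>; the bound then passes
  to the limit.\<close>

lemma functional_calculus_lower_bound:
  fixes A :: "'h::complex_hilbert_space \<Rightarrow>\<^sub>L 'h"
  assumes A: "self_adjoint A" and spec: "real_spectrum A \<subseteq> {a..b}"
    and cont: "continuous_on {a..b} g" and m: "\<And>t. t \<in> {a..b} \<Longrightarrow> m \<le> g t"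
  shows "m * (norm x)\<^sup>2 \<le> rinner (functional_calculus g A x) x"
proof -
  obtain p :: "nat \<Rightarrow> real poly"
    where p: "\<And>n t. t \<in> {a..b} \<Longrightarrow> \<bar>poly (p n) t - g t\<bar> < 1 / real (Suc n)"
    using polynomial_approximation[OF cont] by metis
  have "uniform_limit (real_spectrum A) (\<lambda>n. poly (p n)) g sequentially"
  proof (rule uniform_limitI)
    fix e :: real assume "e > 0"
    have "\<forall>\<^sub>F n in sequentially. 1 / real (Suc n) < e"
      using order_tendstoD(2)[OF LIMSEQ_inverse_real_of_nat \<open>e > 0\<close>] by (simp add: inverse_eq_divide)
    then show "\<forall>\<^sub>F n in sequentially. \<forall>t\<in>real_spectrum A. dist (poly (p n) t) (g t) < e"
    proof eventually_elim
      case (elim n)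
      show ?case
      proof
        fix t assume "t \<in> real_spectrum A"
        then show "dist (poly (p n) t) (g t) < e"
          using p[of t n] spec elim unfolding dist_real_def by (meson less_trans subsetD)
      qed
    qed
  qed
  then have "(\<lambda>n. poly_op (p n) A) \<longlonglongrightarrow> functional_calculus g A"
    by (rule functional_calculus_limit[OF A])
  then have lim: "(\<lambda>n. rinner (poly_op (p n) A x) x) \<longlonglongrightarrow> rinner (functional_calculus g A x) x"
    by (intro tendsto_rinner_left blinfun.tendsto tendsto_const)
  have "(m - 1 / real (Suc n)) * (norm x)\<^sup>2 \<le> rinner (poly_op (p n) A x) x" for n
  proof -
    have "0 \<le> rinner (poly_op (p n - [:m - 1 / real (Suc n):]) A x) x"
    proof (rule rinner_poly_op_nonneg[OF A])
      fix t assume "t \<in> real_spectrum A"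
      then have "t \<in> {a..b}" using spec by blast
      then show "0 \<le> poly (p n - [:m - 1 / real (Suc n):]) t"
        using p[of t n] m[of t] by (simp add: abs_less_iff)
    qed
    then show ?thesis
      unfolding poly_op_diff poly_op_const blinfun.diff_left blinfun.scaleR_left rinner_diff_left
        rinner_scaleR_left by (simp add: rinner_self)
  qed
  moreover have "(\<lambda>n. (m - inverse (real (Suc n))) * (norm x)\<^sup>2) \<longlonglongrightarrow> (m - 0) * (norm x)\<^sup>2"
    by (intro tendsto_intros LIMSEQ_inverse_real_of_nat)
  ultimately show ?thesis
    using LIMSEQ_le[OF _ lim] by (auto simp: inverse_eq_divide)
qed

section \<open>The inequality, from the lower bound for the calculus and the ratio condition\<close>

theorem theorem2p14:
  fixes a b :: real
    and f g :: "real \<Rightarrow> real"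
    and A :: "'h::complex_hilbert_space \<Rightarrow>\<^sub>L 'h"
    and h :: 'h
  assumes "0 \<le> a" and "a \<le> b"
    and "f \<in> {a..b} \<rightarrow> {0..}" and "g \<in> {a..b} \<rightarrow> {0..}"
    and "f differentiable_on {a..b}" and "g differentiable_on {a..b}"
    and "mono_on {a..b} f" and "concave_on {a..b} f"
    and "convex_on {a..b} g"
    and "\<And>x. x \<in> {a..b} \<Longrightarrow> g x \<le> f x"
    and "M_ratio a b f g * ereal (g b - g a) \<le> ereal (f b - f a)"
    and "0 \<le> M_ratio a b f g * ereal (g b - g a)"
    and "positive_op A"
    and "op_le (a *\<^sub>R id_blinfun) A" and "op_le A (b *\<^sub>R id_blinfun)"
    and "norm h = 1"
  shows "(g b - g a) * f (Re (cinner (A h) h))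
      \<le> (f b - f a) * Re (cinner (functional_calculus g A h) h)"
proof -
  define m where "m = (INF x\<in>{a..b}. g x)"
  define r where "r = rinner (functional_calculus g A h) h"
  have f_le: "f x \<le> f b" if "x \<in> {a..b}" for x
    using mono_onD[OF assms(7)] that by auto
  have f_nonneg: "0 \<le> f x" and g_nonneg: "0 \<le> g x" if "x \<in> {a..b}" for x
    using assms(3,4) that by auto
  have sup: "(SUP x\<in>{a..b}. f x) = f b"
    using assms(2) f_le by (intro cSup_eq_maximum) auto
  have m_le: "m \<le> g x" if "x \<in> {a..b}" for x
    unfolding m_def using g_nonneg by (intro cINF_lower[OF _ that]) (auto intro!: bdd_belowI2[of _ 0])
  have m_nonneg: "0 \<le> m"
    unfolding m_def using assms(2) g_nonneg by (intro cINF_greatest) auto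
  have A: "self_adjoint A"
    using assms(13) by (simp add: positive_op_def)
  have lower: "a * (norm x)\<^sup>2 \<le> rinner (A x) x" for x
  proof -
    have "0 \<le> rinner ((A - a *\<^sub>R id_blinfun) x) x"
      using assms(14) by (simp add: op_le_def positive_op_def)
    then show ?thesis
      unfolding blinfun.diff_left blinfun.scaleR_left rinner_diff_left rinner_scaleR_left
      by (simp add: rinner_self)
  qed
  have upper: "rinner (A x) x \<le> b * (norm x)\<^sup>2" for x
  proof -
    have "0 \<le> rinner ((b *\<^sub>R id_blinfun - A) x) x"
      using assms(15) by (simp add: op_le_def positive_op_def)
    then show ?thesis
      unfolding blinfun.diff_left blinfun.scaleR_left rinner_diff_left rinner_scaleR_left
      by (simp add: rinner_self)
  qed
  \<comment> \<open>Places the argument of \<open>f\<close> in the interval, where \<open>f\<close>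
    is at most \<open>f b\<close>.\<close>
  have mean: "rinner (A h) h \<in> {a..b}"
    using lower[of h] upper[of h] assms(16) by simp
  have "m * (norm h)\<^sup>2 \<le> r"
    unfolding r_def
    by (rule functional_calculus_lower_bound[OF A real_spectrum_subset[OF A lower upper] _ m_le])
      (use assms(6) differentiable_imp_continuous_on in auto)
  then have "m \<le> r" using assms(16) by simp
  have f_mono: "f a \<le> f b" using f_le assms(2) by simp
  have "(g b - g a) * f (rinner (A h) h) \<le> (f b - f a) * r"
  proof (cases "m = 0")
    case True
    have "g b = g a"
    \<comment> \<open>If \<open>f b = 0\<close>, the ratio is \<open>0 / 0 = 0\<close> and its
      condition says nothing about \<open>g\<close>; instead \<open>g\<close> is squeezed to zero at
      both endpoints by \<open>0 \<le> g \<le> f \<le> f b\<close>.\<close>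
    proof (cases "f b = 0")
      case True
      then show ?thesis
        using assms(2) assms(10)[of a] assms(10)[of b] f_mono g_nonneg[of a] g_nonneg[of b] by auto
    next
      case False
      then have "f b > 0" using f_nonneg[of b] assms(2) by simp
      then have "M_ratio a b f g = \<infinity>"
        using \<open>m = 0\<close> by (simp add: M_ratio_def sup divide_ereal_def flip: m_def zero_ereal_def)
      \<comment> \<open>With an infinite ratio, a positive \<open>g b - g a\<close> breaks the
        finite upper bound and a negative one breaks nonnegativity.\<close>
      then show ?thesis
        using assms(11,12) by (cases "g b - g a" "0 :: real" rule: linorder_cases) auto
    qed
    then show ?thesis
      using f_mono \<open>m \<le> r\<close> m_nonneg by simp
  next
    case False
    then have "m > 0" using m_nonneg by simp
    then have "f b > 0" using m_le[of b] assms(10)[of b] assms(2) by simp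
    have ratio: "M_ratio a b f g = ereal (f b / m)"
      using False by (simp add: M_ratio_eq_real sup flip: m_def)
    have "0 \<le> f b / m * (g b - g a)" and le: "f b / m * (g b - g a) \<le> f b - f a"
      using assms(11,12) by (simp_all add: ratio)
    then have "0 \<le> g b - g a"
      using \<open>m > 0\<close> \<open>f b > 0\<close> by (simp add: zero_le_mult_iff zero_le_divide_iff)
    then have "(g b - g a) * f (rinner (A h) h) \<le> (g b - g a) * f b"
      using f_le[OF mean] by (rule mult_left_mono[rotated])
    \<comment> \<open>Splitting off \<open>m\<close> allows a comparison factor by factor: the ratio
      condition for the first factor, \<open>m \<le> r\<close> for the second.\<close>
    also have "\<dots> = f b / m * (g b - g a) * m"
      using \<open>m > 0\<close> by simp
    also have "\<dots> \<le> (f b - f a) * r"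
      using le \<open>m \<le> r\<close> f_mono m_nonneg by (intro mult_mono) auto
    finally show ?thesis .
  qed
  then show ?thesis by (simp add: r_def)
qed

end
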